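(* Let $f:\mathbb{R}\to\mathbb{R}$ be continuous with $f(0)=0$ and $xf(x)>0$ for all $x\neq 0$. Suppose that there exists an odd function $\phi$ on $\mathbb{R}$ such that $\lim_{x\to 0} f(x)/\phi(x)=1$, that $f\in \mathrm{RV}_0(\beta)$ for some $\beta>1$, and that $\lim_{x\to 0^+} f(x)/x=0$. Let $\Gamma\in C^1([0,\infty);(0,\infty))$ satisfy $\lim_{t\to\infty}\Gamma(t)=+\infty$. Then there exists a function $g\in C^1((0,\infty);(0,\infty))$, continuous on $[0,\infty)$, such that $\lim_{t\to\infty}\int_0^t g(s)\,ds$ exists and is finite, $$\lim_{t\to\infty}\frac{\int_t^\infty g(s)\,ds}{F^{-1}(t)}=0,\qquad \limsup_{t\to\infty}\frac{|g(t)|}{\Gamma(t)}=1,$$ and hence any continuous solution $x$ on $[0,\infty)$ of $$x'(t)=-f(x(t))+g(t),\quad t>0;\qquad x(0)=\xi\in\mathbb{R},$$ is such that there exists $\lambda\in\{-1,0,1\}$ with $\lim_{t\to\infty}x(t)/F^{-1}(t)=\lambda$.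
   Context: A function $f$ which is positive and measurable on $(0,\infty)$ is regularly varying at $0$ with index $\beta\in\mathbb{R}$, written $f\in\mathrm{RV}_0(\beta)$, if $\lim_{x\to0^+} f(\lambda x)/f(x)=\lambda^\beta$ for every $\lambda>0$ (for $f$ defined on $\mathbb{R}$ this refers to its restriction to $(0,\infty)$). Define $F(x)=\int_x^1 \frac{1}{f(u)}\,du$ for $x>0$. $F$ is strictly decreasing; since $\beta>1$, $F(x)\to\infty$ as $x\to0^+$. $F^{-1}$ denotes the inverse function of $F$; $F^{-1}(t)>0$ is defined for all $t\ge 0$ and tends to $0$ as $t\to\infty$. *)

theory Defs
  imports "HOL-Analysis.Analysis"
begin

definition RV0 :: "real \<Rightarrow> (real \<Rightarrow> real) set" where
  "RV0 \<beta> = {f. (\<forall>x>0. f x > 0) \<and> f \<in> borel_measurable (lebesgue_on {0<..}) \<and>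
     (\<forall>c>0. ((\<lambda>x. f (c * x) / f x) \<longlongrightarrow> c powr \<beta>) (at_right 0))}"

text \<open>Derivatives are taken relative to \<open>S\<close>, hence one-sided at \<open>0\<close> for \<open>S = {0..}\<close>, where
  the library's \<open>C1_differentiable_on\<close> would instead require a two-sided derivative and thus
  depend on the values of the function outside \<open>S\<close>.\<close>

definition C1_maps :: "real set \<Rightarrow> real set \<Rightarrow> (real \<Rightarrow> real) set" where
  "C1_maps S Y = {h. h \<in> S \<rightarrow> Y \<and>
     (\<exists>h'. (\<forall>t\<in>S. (h has_real_derivative h' t) (at t within S)) \<and> continuous_on S h')}"

text \<open>The interval integral is oriented, so \<open>F_fun f x\<close> is negative for \<open>x > 1\<close> if \<open>f\<close> is
  continuous and positive on \<open>{0<..}\<close>.\<close>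

definition F_fun :: "(real \<Rightarrow> real) \<Rightarrow> real \<Rightarrow> real" where
  "F_fun f x = (LBINT u=x..1. 1 / f u)"

definition F_inv :: "(real \<Rightarrow> real) \<Rightarrow> real \<Rightarrow> real" where
  "F_inv f = inv_into {0<..} (F_fun f)"

definition solves_on_half_line ::
  "(real \<Rightarrow> real) \<Rightarrow> (real \<Rightarrow> real) \<Rightarrow> real \<Rightarrow> (real \<Rightarrow> real) \<Rightarrow> bool" where
  "solves_on_half_line f g \<xi> x \<longleftrightarrow>
     continuous_on {0..} x \<and> x 0 = \<xi> \<and>
     (\<forall>t>0. (x has_real_derivative (- f (x t) + g t)) (at t))"

end

theory Submission
  imports Defs
begin

text \<open>
  The unforced equation \<open>x' = - f x\<close> has the explicit first integral \<open>F (x t) = F (x 0) + t\<close>, so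
  its positive solutions decay like \<open>F_inv f t\<close>. The limsup condition fixes the height of the
  forcing \<open>g\<close> infinitely often, but not its mass: \<open>g\<close> is taken to be
  \<open>\<Gamma> t * exp (- M t * (sin (pi * t))^2)\<close>, which equals \<open>\<Gamma>\<close> at the integers and is negligible
  elsewhere once the C1 function \<open>M\<close> grows fast enough. In this way the tail \<open>G t\<close>, the integral of
  \<open>g\<close> over \<open>{t..}\<close>, can be put below any prescribed positive sequence
  (\<open>C1_spikes_with_small_mass\<close>, \<open>tail_integral_below_sequence\<close>).

  A solution is studied through \<open>z = x + G\<close>, for which the spikes disappear:
  \<open>z' = - f (z - G)\<close>. Because \<open>g > 0\<close>, \<open>x\<close> can cross zero only upwards; hence \<open>z\<close> is eventually
  monotone, of constant sign \<open>\<sigma>\<close>, and tends to \<open>0\<close> (\<open>eventual_sign_and_decay\<close>).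
  Put \<open>v = \<sigma> * z > 0\<close> and \<open>y = F (v t)\<close>. Then \<open>y' = \<sigma> * f (\<sigma> * v - G) / f v\<close>. The tail \<open>G\<close> is chosen
  so small, by uniform continuity of \<open>f\<close> on compact sets avoiding \<open>0\<close>, that \<open>y'\<close> is close to \<open>1\<close>
  whenever \<open>y t \<le> t^2\<close>; this is where asymptotic oddness of \<open>f\<close> enters if \<open>\<sigma> = -1\<close>.

  The curve \<open>t^2\<close> is then a barrier, since it rises faster than \<open>y\<close> at any contact point. Either \<open>y\<close>
  stays above it eventually, or \<open>y\<close> does not exceed it from some time on, and then \<open>y' \<longlongrightarrow> 1\<close>, so
  that \<open>y t / t \<longlongrightarrow> 1\<close> (\<open>growth_dichotomy\<close>). Regular variation gives \<open>F (c * x) / F x \<longlongrightarrow> c powr (1 - \<beta>)\<close>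
  by L'Hopital's rule, and since \<open>\<beta> > 1\<close> this turns the two alternatives into \<open>v / F_inv f \<longlongrightarrow> 0\<close> and
  \<open>v / F_inv f \<longlongrightarrow> 1\<close>. Since \<open>x = \<sigma> * v - G\<close> with \<open>G = o(F_inv f)\<close>, the limit of \<open>x / F_inv f\<close> is \<open>0\<close>
  or \<open>\<sigma>\<close>.
\<close>

section \<open>Functions on a half-line\<close>

text \<open>
  At the last time at which \<open>h\<close> is still nonnegative it would have to vanish, and there its
  derivative is positive, so it cannot become negative immediately afterwards.
\<close>
lemma barrier_nonneg:
  fixes h :: "real \<Rightarrow> real"
  assumes cont: "continuous_on {T..} h" and start: "0 \<le> h T"
    and cross: "\<And>t. T \<le> t \<Longrightarrow> h t = 0 \<Longrightarrow> \<exists>D>0. (h has_real_derivative D) (at t)"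
    and t: "T \<le> t"
  shows "0 \<le> h t"
proof (rule ccontr)
  assume neg: "\<not> 0 \<le> h t"
  define Z where "Z = {T..t} \<inter> h -` {0..}"
  have "closed Z"
    unfolding Z_def
    by (rule continuous_closed_preimage[OF continuous_on_subset[OF cont]]) auto
  then have "compact Z"
    unfolding Z_def by (metis compact_Icc compact_Int_closed inf.left_idem)
  moreover have "T \<in> Z"
    using start t by (auto simp: Z_def)
  ultimately obtain s where s: "s \<in> Z" and max: "\<And>r. r \<in> Z \<Longrightarrow> r \<le> s"
    using compact_attains_sup[of Z] by auto
  have st: "T \<le> s" "s < t" "0 \<le> h s"
    using s neg by (auto simp: Z_def order.order_iff_strict)
  have "\<exists>r\<ge>s. r \<le> t \<and> h r = 0"
    using IVT2'[of h t 0 s] st neg continuous_on_subset[OF cont, of "{s..t}"] by auto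
  then obtain r where r: "s \<le> r" "r \<le> t" "h r = 0"
    by blast
  then have "r = s"
    using max[of r] st by (auto simp: Z_def)
  with r st cross obtain D where "D > 0" "(h has_real_derivative D) (at s)"
    by blast
  then obtain d where d: "d > 0" "\<And>e. 0 < e \<Longrightarrow> e < d \<Longrightarrow> h s < h (s + e)"
    using DERIV_pos_inc_right by blast
  define e where "e = min (d / 2) (t - s)"
  have "0 < e" "e < d" "s + e \<le> t"
    using d st by (auto simp: e_def)
  with d(2)[of e] st have "s + e \<in> Z"
    by (auto simp: Z_def)
  with max[of "s + e"] \<open>0 < e\<close> show False by simp
qed

text \<open>
  L'Hopital's rule with denominator \<open>t\<close>. It serves twice: to exclude a nonzero limit of the derivative
  of a convergent function, and to obtain \<open>y t / t \<longlongrightarrow> 1\<close> from \<open>y' \<longlongrightarrow> 1\<close>.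
\<close>
lemma average_slope_tendsto:
  fixes h :: "real \<Rightarrow> real"
  assumes "\<forall>\<^sub>F t in at_top. (h has_real_derivative h' t) (at t)" and "(h' \<longlongrightarrow> c) at_top"
  shows "((\<lambda>t. h t / t) \<longlongrightarrow> c) at_top"
  by (rule lhospital_at_top_at_top[where f' = h' and g' = "\<lambda>_. 1"])
     (use assms in \<open>auto simp: filterlim_ident\<close>)

lemma convergent_imp_slope_limit_0:
  fixes h :: "real \<Rightarrow> real"
  assumes "\<forall>\<^sub>F t in at_top. (h has_real_derivative h' t) (at t)" and "(h' \<longlongrightarrow> c) at_top"
    and "(h \<longlongrightarrow> l) at_top"
  shows "c = 0"
proof -
  have "((\<lambda>t. h t / t) \<longlongrightarrow> 0) at_top"
    by (rule tendsto_divide_0[OF assms(3)])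
       (simp add: filterlim_at_top_imp_at_infinity filterlim_ident)
  with average_slope_tendsto[OF assms(1,2)] show ?thesis
    using tendsto_unique[OF trivial_limit_at_top_linorder] by blast
qed

text \<open>
  Besides the limit itself, the bounds on it are recorded: they are what shows that a tail integral
  is small and that a monotone solution does not change sign.
\<close>
lemma mono_bounded_tendsto_at_top:
  fixes h :: "real \<Rightarrow> real"
  assumes mono: "\<And>s t. T \<le> s \<Longrightarrow> s \<le> t \<Longrightarrow> h s \<le> h t" and bound: "\<And>t. T \<le> t \<Longrightarrow> h t \<le> B"
  obtains L where "(h \<longlongrightarrow> L) at_top" "\<And>t. T \<le> t \<Longrightarrow> h t \<le> L" "L \<le> B"
proof
  define L where "L = (SUP t\<in>{T..}. h t)"
  have bdd: "bdd_above (h ` {T..})"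
    using bound by (auto simp: bdd_above_def)
  show le: "h t \<le> L" if "T \<le> t" for t
    unfolding L_def by (rule cSUP_upper[OF _ bdd]) (use that in auto)
  show "L \<le> B"
    unfolding L_def by (rule cSUP_least) (use bound in auto)
  show "(h \<longlongrightarrow> L) at_top"
  proof (rule increasing_tendsto)
    show "\<forall>\<^sub>F t in at_top. h t \<le> L"
      using eventually_ge_at_top[of T] by eventually_elim (rule le)
    fix a assume "a < L"
    then obtain s where s: "T \<le> s" "a < h s"
      using less_cSUP_iff[OF _ bdd] by (auto simp: L_def)
    show "\<forall>\<^sub>F t in at_top. a < h t"
      using eventually_ge_at_top[of s] by eventually_elim (use s mono in force)
  qed
qed

text \<open>
  The slope of \<open>y\<close> is controlled only below the parabola \<open>t^2\<close>. At a contact point the parabola has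
  slope \<open>2 * t \<ge> 2\<close> while \<open>y\<close> has slope less than \<open>2\<close>, so \<open>y\<close> cannot leave the region below it.
\<close>
lemma growth_dichotomy:
  fixes y r :: "real \<Rightarrow> real"
  assumes y: "\<forall>\<^sub>F t in at_top. (y has_real_derivative r t) (at t)"
    and r: "\<And>e. e > 0 \<Longrightarrow> \<forall>\<^sub>F t in at_top. y t \<le> t\<^sup>2 \<longrightarrow> \<bar>r t - 1\<bar> < e"
  shows "(\<forall>\<^sub>F t in at_top. y t > t\<^sup>2) \<or> ((\<lambda>t. y t / t) \<longlongrightarrow> 1) at_top"
proof (cases "\<forall>\<^sub>F t in at_top. y t > t\<^sup>2")
  case False
  have "\<forall>\<^sub>F t in at_top. t \<ge> 1 \<and> (y has_real_derivative r t) (at t) \<and> (y t \<le> t\<^sup>2 \<longrightarrow> \<bar>r t - 1\<bar> < 1)"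
    by (intro eventually_conj y r eventually_ge_at_top) simp
  then obtain T0 where T0: "\<And>t. t \<ge> T0 \<Longrightarrow> t \<ge> 1" "\<And>t. t \<ge> T0 \<Longrightarrow> (y has_real_derivative r t) (at t)"
      "\<And>t. t \<ge> T0 \<Longrightarrow> y t \<le> t\<^sup>2 \<Longrightarrow> \<bar>r t - 1\<bar> < 1"
    unfolding eventually_at_top_linorder by blast
  from False obtain T where T: "T \<ge> T0" "y T \<le> T\<^sup>2"
    unfolding eventually_at_top_linorder by (meson not_less)
  have der: "((\<lambda>t. t\<^sup>2 - y t) has_real_derivative 2 * t - r t) (at t)" if "t \<ge> T" for t
    using that T by (auto intro!: derivative_eq_intros T0(2))
  have below: "0 \<le> t\<^sup>2 - y t" if t: "T \<le> t" for t
  proof (rule barrier_nonneg[where h = "\<lambda>t. t\<^sup>2 - y t", OF _ _ _ t])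
    show "continuous_on {T..} (\<lambda>t. t\<^sup>2 - y t)"
      by (rule DERIV_continuous_on[OF has_field_derivative_at_within[OF der]]) simp
    show "0 \<le> T\<^sup>2 - y T" using T by simp
    show "\<exists>D>0. ((\<lambda>t. t\<^sup>2 - y t) has_real_derivative D) (at s)" if "T \<le> s" "s\<^sup>2 - y s = 0" for s
      using der[OF that(1)] T0(1)[of s] T0(3)[of s] T that by (intro exI[of _ "2 * s - r s"]) auto
  qed
  have "(r \<longlongrightarrow> 1) at_top"
  proof (rule tendstoI)
    fix e :: real assume "e > 0"
    from r[OF this] eventually_ge_at_top[of T]
    show "\<forall>\<^sub>F t in at_top. dist (r t) 1 < e"
      by eventually_elim (use below in \<open>simp add: dist_real_def\<close>)
  qed
  with average_slope_tendsto[OF y] show ?thesis by blast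
qed simp

text \<open>
  On the compact set \<open>c \<le> \<bar>u\<bar> \<le> 1\<close> the function \<open>\<bar>f\<bar>\<close> is bounded away from \<open>0\<close>, so that uniform continuity
  yields an estimate relative to \<open>\<bar>f u\<bar>\<close>. It takes the place of the uniform convergence theorem for
  regularly varying functions: a perturbation that is small enough for this \<open>\<delta>\<close> does not change
  \<open>f\<close> asymptotically, whatever the oscillation of \<open>f\<close>.
\<close>
lemma relative_modulus_of_continuity:
  fixes f :: "real \<Rightarrow> real"
  assumes cont: "continuous_on UNIV f" and nz: "\<And>u. u \<noteq> 0 \<Longrightarrow> f u \<noteq> 0" and "c > 0" "\<epsilon> > 0"
  shows "\<exists>\<delta>>0. \<forall>u s. c \<le> \<bar>u\<bar> \<longrightarrow> \<bar>u\<bar> \<le> 1 \<longrightarrow> 0 \<le> s \<longrightarrow> s \<le> \<delta> \<longrightarrow> \<bar>f (u - s) - f u\<bar> \<le> \<epsilon> * \<bar>f u\<bar>"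
proof -
  define K where "K = {-1..-c} \<union> {c..1::real}"
  have K: "u \<in> K \<longleftrightarrow> c \<le> \<bar>u\<bar> \<and> \<bar>u\<bar> \<le> 1" for u
    using \<open>c > 0\<close> by (auto simp: K_def)
  have "\<exists>\<mu>>0. \<forall>u\<in>K. \<mu> \<le> \<bar>f u\<bar>"
  proof (cases "K = {}")
    case False
    have "compact K" by (auto simp: K_def)
    moreover have "continuous_on K (\<lambda>u. \<bar>f u\<bar>)"
      by (intro continuous_intros continuous_on_subset[OF cont]) auto
    ultimately obtain v where v: "v \<in> K" "\<And>u. u \<in> K \<Longrightarrow> \<bar>f v\<bar> \<le> \<bar>f u\<bar>"
      using continuous_attains_inf[of K] False by blast
    have "v \<noteq> 0"
      using v(1) K[of v] \<open>c > 0\<close> by auto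
    then have "\<bar>f v\<bar> > 0"
      using nz by simp
    with v(2) show ?thesis by blast
  qed (auto intro: exI[of _ 1])
  then obtain \<mu> where \<mu>: "\<mu> > 0" "\<And>u. u \<in> K \<Longrightarrow> \<mu> \<le> \<bar>f u\<bar>" by blast
  have "uniformly_continuous_on {-2..2} f"
    by (intro compact_uniformly_continuous continuous_on_subset[OF cont]) auto
  moreover have "\<epsilon> * \<mu> > 0"
    using \<mu> \<open>\<epsilon> > 0\<close> by simp
  ultimately obtain d where d: "d > 0"
    "\<And>u v. u \<in> {-2..2} \<Longrightarrow> v \<in> {-2..2} \<Longrightarrow> dist v u < d \<Longrightarrow> dist (f v) (f u) < \<epsilon> * \<mu>"
    unfolding uniformly_continuous_on_def by blast
  show ?thesis
  proof (intro exI[of _ "min (d / 2) 1"] conjI allI impI)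
    fix u s assume u: "c \<le> \<bar>u\<bar>" "\<bar>u\<bar> \<le> 1" and s: "0 \<le> s" "s \<le> min (d / 2) 1"
    have "\<bar>f (u - s) - f u\<bar> < \<epsilon> * \<mu>"
      using d(2)[of u "u - s"] u s d(1) by (auto simp: dist_real_def)
    also have "\<dots> \<le> \<epsilon> * \<bar>f u\<bar>"
      using \<mu>(2)[of u] u K \<open>\<epsilon> > 0\<close> by simp
    finally show "\<bar>f (u - s) - f u\<bar> \<le> \<epsilon> * \<bar>f u\<bar>" by simp
  qed (use d in auto)
qed

text \<open>
  The auxiliary odd function cancels; what remains is a property of \<open>f\<close> alone.
\<close>
lemma asymptotically_odd_reflection:
  fixes f \<phi> :: "real \<Rightarrow> real"
  assumes odd: "\<And>x. \<phi> (- x) = - \<phi> x" and lim: "((\<lambda>x. f x / \<phi> x) \<longlongrightarrow> 1) (at 0)"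
  shows "((\<lambda>u. - f (- u) / f u) \<longlongrightarrow> 1) (at_right 0)"
proof -
  have R: "((\<lambda>u. f u / \<phi> u) \<longlongrightarrow> 1) (at_right 0)" and "((\<lambda>x. f x / \<phi> x) \<longlongrightarrow> 1) (at_left 0)"
    using lim by (auto simp: filterlim_at_split)
  then have L: "((\<lambda>u. f (- u) / \<phi> (- u)) \<longlongrightarrow> 1) (at_right 0)"
    by (simp add: filterlim_at_left_to_right)
  have "((\<lambda>u. (f (- u) / \<phi> (- u)) / (f u / \<phi> u)) \<longlongrightarrow> 1 / 1) (at_right 0)"
    by (intro tendsto_divide L R) simp
  moreover have "\<forall>\<^sub>F u in at_right 0. (f (- u) / \<phi> (- u)) / (f u / \<phi> u) = - f (- u) / f u"
    using order_tendstoD(1)[OF R, of "1/2"]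
    by (auto elim!: eventually_mono simp: odd divide_simps)
  ultimately show ?thesis
    by (simp add: tendsto_cong)
qed

text \<open>
  If \<open>x\<close> is nonnegative once, then it remains so, because \<open>x' = g > 0\<close> at a zero; then \<open>z = x + G\<close> is
  positive and decreasing. Otherwise \<open>x < 0\<close> throughout, and \<open>z\<close> is strictly increasing. In both cases
  \<open>z\<close> converges, and so does \<open>z' = - f x\<close>, whose limit must be \<open>0\<close>; thus the limit of \<open>z\<close> is the only
  zero of \<open>f\<close>.
\<close>
lemma eventual_sign_and_decay:
  fixes f g G x :: "real \<Rightarrow> real"
  assumes f_cont: "continuous_on UNIV f" and f_sign: "\<And>u. u \<noteq> 0 \<Longrightarrow> u * f u > 0" and f0: "f 0 = 0"
    and g: "\<And>t. t > 0 \<Longrightarrow> g t > 0"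
    and G: "\<And>t. t > 0 \<Longrightarrow> (G has_real_derivative - g t) (at t)" "\<And>t. t > 0 \<Longrightarrow> G t > 0"
    and G0: "(G \<longlongrightarrow> 0) at_top"
    and x: "\<And>t. t > 0 \<Longrightarrow> (x has_real_derivative - f (x t) + g t) (at t)"
  obtains \<sigma> :: real where "\<sigma> \<in> {-1, 1}" "\<forall>\<^sub>F t in at_top. \<sigma> * (x t + G t) > 0"
    "((\<lambda>t. x t + G t) \<longlongrightarrow> 0) at_top"
proof -
  define z where "z = (\<lambda>t. x t + G t)"
  have z': "(z has_real_derivative - f (x t)) (at t)" if "t > 0" for t
    unfolding z_def using DERIV_add[OF x[OF that] G(1)[OF that]] by simp
  have limit_0: "l = 0" if l: "(z \<longlongrightarrow> l) at_top" for l
  proof -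
    have "((\<lambda>t. z t - G t) \<longlongrightarrow> l - 0) at_top"
      by (intro tendsto_intros l G0)
    then have "(x \<longlongrightarrow> l) at_top"
      by (simp add: z_def)
    then have "((\<lambda>t. - f (x t)) \<longlongrightarrow> - f l) at_top"
      using f_cont by (intro tendsto_minus isCont_tendsto_compose[of l f])
        (auto simp: continuous_on_eq_continuous_at)
    moreover have "\<forall>\<^sub>F t in at_top. (z has_real_derivative - f (x t)) (at t)"
      using eventually_gt_at_top[of 0] by eventually_elim (rule z')
    ultimately have "- f l = 0"
      using convergent_imp_slope_limit_0[of z "\<lambda>t. - f (x t)"] l by blast
    with f_sign[of l] show ?thesis by auto
  qed
  show thesis
  proof (cases "\<exists>T>0. x T \<ge> 0")
    case True
    then obtain T where T: "T > 0" "x T \<ge> 0" by blast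
    have x_nonneg: "x t \<ge> 0" if t: "T \<le> t" for t
    proof (rule barrier_nonneg[where h = x, OF _ T(2) _ t])
      show "continuous_on {T..} x"
        by (rule DERIV_continuous_on[OF has_field_derivative_at_within[OF x]]) (use T in simp)
      show "\<exists>D>0. (x has_real_derivative D) (at s)" if "T \<le> s" "x s = 0" for s
        using x[of s] g[of s] that T f0 by (intro exI[of _ "g s"]) auto
    qed
    have z_pos: "z t > 0" if "T \<le> t" for t
      using x_nonneg[OF that] G(2)[of t] that T by (simp add: z_def)
    have z_dec: "- z s \<le> - z t" if "T \<le> s" "s \<le> t" for s t
    proof -
      have "z t \<le> z s"
      proof (rule DERIV_nonpos_imp_nonincreasing[OF that(2)])
        fix r assume r: "s \<le> r" "r \<le> t"
        then have "f (x r) \<ge> 0"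
          using x_nonneg[of r] f_sign[of "x r"] f0 that(1)
          by (cases "x r = 0") (auto simp: zero_less_mult_iff)
        then show "\<exists>D. (z has_real_derivative D) (at r) \<and> D \<le> 0"
          using z'[of r] r that T by (intro exI[of _ "- f (x r)"]) auto
      qed
      then show ?thesis by simp
    qed
    have "- z t \<le> 0" if "T \<le> t" for t
      using z_pos[OF that] by simp
    from mono_bounded_tendsto_at_top[of T "\<lambda>t. - z t" 0, OF z_dec this]
    obtain l where "((\<lambda>t. - z t) \<longlongrightarrow> l) at_top" by blast
    from tendsto_minus[OF this] have "(z \<longlongrightarrow> - l) at_top" by simp
    with limit_0 have "(z \<longlongrightarrow> 0) at_top" by metis
    moreover have "\<forall>\<^sub>F t in at_top. 1 * z t > 0"
      using eventually_ge_at_top[of T] by eventually_elim (simp add: z_pos)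
    ultimately show thesis
      using that[of 1] by (simp add: z_def)
  next
    case False
    then have x_neg: "x t < 0" if "t > 0" for t
      using that by force
    have z_inc: "z s < z t" if "0 < s" "s < t" for s t
    proof (rule DERIV_pos_imp_increasing[OF that(2)])
      fix r assume r: "s \<le> r" "r \<le> t"
      then have "f (x r) < 0"
        using x_neg[of r] f_sign[of "x r"] that by (auto simp: zero_less_mult_iff)
      then show "\<exists>D. (z has_real_derivative D) (at r) \<and> D > 0"
        using z'[of r] r that by (intro exI[of _ "- f (x r)"]) auto
    qed
    have mono: "z s \<le> z t" if "1 \<le> s" "s \<le> t" for s t
      using z_inc[of s t] that by (cases "s = t") auto
    have G_dec: "G t \<le> G 1" if "1 \<le> t" for t
    proof (rule DERIV_nonpos_imp_nonincreasing[OF that])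
      show "\<exists>D. (G has_real_derivative D) (at r) \<and> D \<le> 0" if "1 \<le> r" "r \<le> t" for r
        using G(1)[of r] g[of r] that by (intro exI[of _ "- g r"]) auto
    qed
    have "z t \<le> G 1" if "1 \<le> t" for t
      using x_neg[of t] G_dec[OF that] that by (simp add: z_def)
    from mono_bounded_tendsto_at_top[of 1 z "G 1", OF mono this]
    obtain l where l: "(z \<longlongrightarrow> l) at_top" "\<And>t. 1 \<le> t \<Longrightarrow> z t \<le> l" by blast
    have "l = 0" by (rule limit_0[OF l(1)])
    have "z t < 0" if "1 \<le> t" for t
      using z_inc[of t "t + 1"] l(2)[of "t + 1"] that \<open>l = 0\<close> by simp
    then have "\<forall>\<^sub>F t in at_top. - 1 * z t > 0"
      by (auto intro: eventually_mono[OF eventually_ge_at_top[of 1]])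
    then show thesis
      using that[of "-1"] l(1) \<open>l = 0\<close> by (simp add: z_def)
  qed
qed

section \<open>Forcing by high and thin spikes\<close>

text \<open>
  Integration over \<open>{0..t}\<close> preserves nonnegative monotone functions, gains one order of smoothness
  and loses at most a shift by \<open>1\<close> in size. Two integrations therefore turn a step function into
  a C1 function of at least the same growth.
\<close>
lemma indefinite_integral_of_mono:
  fixes S :: "real \<Rightarrow> real"
  assumes mono: "mono_on {0..} S" and nonneg: "\<And>u. 0 \<le> u \<Longrightarrow> 0 \<le> S u"
  defines "I \<equiv> \<lambda>t. integral {0..t} S"
  shows "mono_on {0..} I" "0 \<le> I t" "1 \<le> t \<Longrightarrow> S (t - 1) \<le> I t" "continuous_on {0..b} I"
proof -
  have int: "S integrable_on {a..b}" if "0 \<le> a" for a b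
    by (rule integrable_on_mono_on[OF mono_on_subset[OF mono]]) (use that in auto)
  show "mono_on {0..} I"
    unfolding I_def by (intro mono_onI integral_subset_le int) (auto intro: nonneg)
  show "0 \<le> I t"
    unfolding I_def by (intro integral_nonneg int) (auto intro: nonneg)
  show "continuous_on {0..b} I"
    unfolding I_def by (intro indefinite_integral_continuous_1 int) simp
  assume t: "1 \<le> t"
  have "S (t - 1) = integral {t - 1..t} (\<lambda>_. S (t - 1))"
    by simp
  also have "\<dots> \<le> integral {t - 1..t} S"
    using t by (intro integral_le int integrable_const_ivl mono_onD[OF mono]) auto
  also have "\<dots> \<le> I t"
    unfolding I_def using t by (intro integral_subset_le int) (auto intro: nonneg)
  finally show "S (t - 1) \<le> I t" .
qed

lemma C1_majorant_of_sequence: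
  fixes m :: "nat \<Rightarrow> real"
  obtains M M' :: "real \<Rightarrow> real"
  where "\<And>t. 0 \<le> t \<Longrightarrow> (M has_real_derivative M' t) (at t)" "continuous_on {0..} M'"
    "\<And>n t. real n \<le> t \<Longrightarrow> m n \<le> M t"
proof
  define S where "S u = (\<Sum>k\<le>nat \<lfloor>u\<rfloor>. \<bar>m k\<bar>)" for u :: real
  define I where "I t = integral {0..t} S" for t
  define J where "J t = integral {0..t} I" for t
  have S: "mono_on {0..} S" "\<And>u. 0 \<le> u \<Longrightarrow> 0 \<le> S u"
    by (auto simp: S_def intro!: mono_onI sum_mono2 sum_nonneg nat_mono floor_mono)
  note I = indefinite_integral_of_mono[OF S, folded I_def]
  have I_mono: "mono_on {0..} I"
    using I(1) unfolding I_def .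
  note J = indefinite_integral_of_mono[OF I(1) I(2), folded J_def]
  \<comment> \<open>The argument is shifted by \<open>2\<close> to make up for the loss of \<open>1\<close> at each integration.\<close>
  show "((\<lambda>t. J (t + 2)) has_real_derivative I (t + 2)) (at t)" if "0 \<le> t" for t
  proof -
    have "(J has_real_derivative I (t + 2)) (at (t + 2) within {0..t + 3})"
      unfolding J_def by (rule integral_has_real_derivative[OF I(4)]) (use that in auto)
    then have "(J has_real_derivative I (t + 2)) (at (t + 2))"
      using that by (simp add: at_within_Icc_at)
    then show ?thesis by (simp add: DERIV_shift)
  qed
  show "continuous_on {0..} (\<lambda>t. I (t + 2))"
  proof (rule continuous_at_imp_continuous_on, rule ballI)
    fix t :: real assume t: "t \<in> {0..}"
    have "t + 2 \<in> interior {0..t + 3}"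
      using t by simp
    with I(4) have "isCont I (t + 2)"
      by (rule continuous_on_interior)
    then show "isCont (\<lambda>t. I (t + 2)) t"
      by (intro isCont_o2[where f = "\<lambda>t. t + 2" and g = I]) auto
  qed
  show "m n \<le> J (t + 2)" if "real n \<le> t" for n t
  proof -
    have "n \<le> nat \<lfloor>t\<rfloor>"
      using that by (simp add: le_nat_floor)
    then have "m n \<le> S t"
      unfolding S_def
      using member_le_sum[of n "{..nat \<lfloor>t\<rfloor>}" "\<lambda>k. \<bar>m k\<bar>"] by auto
    also have "\<dots> \<le> I (t + 1)"
      using I(3)[of "t + 1"] that by simp
    also have "\<dots> \<le> J (t + 2)"
      using J(3)[of "t + 2"] that by (simp add: add.commute)
    finally show ?thesis .
  qed
qed

text \<open>
  Inside the unit interval \<open>sin (pi * t)\<close> does not vanish, so the integrand tends to \<open>0\<close> pointwise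
  and is dominated by \<open>\<Gamma>\<close>.
\<close>
lemma thin_spike_integral:
  fixes \<Gamma> :: "real \<Rightarrow> real"
  assumes cont: "continuous_on {0..} \<Gamma>" and nonneg: "\<And>t. 0 \<le> t \<Longrightarrow> 0 \<le> \<Gamma> t" and "a > 0"
  shows "\<exists>k::nat. integral {real n..real n + 1} (\<lambda>t. \<Gamma> t * exp (- (real k * (sin (pi * t))\<^sup>2))) < a"
proof -
  define h where "h k t = \<Gamma> t * exp (- (real k * (sin (pi * t))\<^sup>2))" for k t
  define J where "J = {real n<..<real n + 1}"
  have cont': "continuous_on {real n..real n + 1} \<Gamma>"
    by (rule continuous_on_subset[OF cont]) auto
  \<comment> \<open>The open interval is used since the pointwise limit is not \<open>0\<close> at the integers.\<close>
  have "(\<lambda>k. integral J (h k)) \<longlonglongrightarrow> integral J (\<lambda>_. 0)"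
  proof (rule dominated_convergence)
    show "h k integrable_on J" for k
      unfolding J_def h_def integrable_on_open_interval_real
      by (intro integrable_continuous_real continuous_intros cont')
    show "\<Gamma> integrable_on J"
      unfolding J_def integrable_on_open_interval_real
      by (intro integrable_continuous_real cont')
    show "norm (h k t) \<le> \<Gamma> t" if "t \<in> J" for k t
      using nonneg[of t] that by (auto simp: h_def J_def abs_mult intro!: mult_left_le)
    show "(\<lambda>k. h k t) \<longlonglongrightarrow> 0" if t: "t \<in> J" for t
    proof -
      have "sin (pi * t) \<noteq> 0"
      proof
        assume "sin (pi * t) = 0"
        then obtain i :: int where "pi * t = of_int i * pi"
          unfolding sin_zero_iff_int2 by blast
        then have "t = of_int i" by simp
        with t have "int n < i" "i < int n + 1"
          unfolding J_def by (auto; linarith)+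
        then show False by simp
      qed
      then have "exp (- ((sin (pi * t))\<^sup>2)) < 1"
        by simp
      then have "(\<lambda>k. \<Gamma> t * exp (- ((sin (pi * t))\<^sup>2)) ^ k) \<longlonglongrightarrow> \<Gamma> t * 0"
        by (intro tendsto_intros LIMSEQ_realpow_zero) auto
      then show ?thesis
        by (simp add: h_def flip: exp_of_nat_mult)
    qed
  qed
  then have "\<forall>\<^sub>F k in sequentially. integral J (h k) < a"
    using \<open>a > 0\<close> by (intro order_tendstoD(2)) auto
  then obtain k where "integral J (h k) < a"
    by (auto simp: eventually_sequentially)
  then show ?thesis
    unfolding J_def h_def integral_open_interval_real by blast
qed

text \<open>
  The factor \<open>p t = exp (- M t * (sin (pi * t))^2)\<close> is at most \<open>1\<close>, equals \<open>1\<close> at the integers, and is as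
  thin around them as desired if \<open>M\<close> is large. This reconciles a limsup of \<open>g / \<Gamma>\<close> equal to \<open>1\<close> with
  arbitrarily small integrals over the unit intervals.
\<close>
lemma C1_spikes_with_small_mass:
  fixes \<Gamma> :: "real \<Rightarrow> real" and a :: "nat \<Rightarrow> real"
  assumes C1: "\<Gamma> \<in> C1_maps {0..} {0<..}" and a: "\<And>n. a n > 0"
  obtains g :: "real \<Rightarrow> real"
  where "g \<in> C1_maps {0<..} {0<..}" "continuous_on {0..} g" "\<And>t. 0 \<le> t \<Longrightarrow> 0 < g t"
    "Limsup at_top (\<lambda>t. ereal (\<bar>g t\<bar> / \<Gamma> t)) = 1"
    "\<And>n. integral {real n..real n + 1} g \<le> a n"
proof -
  from C1 obtain \<Gamma>' where \<Gamma>: "\<And>t. 0 \<le> t \<Longrightarrow> \<Gamma> t > 0"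
    and \<Gamma>': "\<And>t. 0 \<le> t \<Longrightarrow> (\<Gamma> has_real_derivative \<Gamma>' t) (at t within {0..})" "continuous_on {0..} \<Gamma>'"
    unfolding C1_maps_def by auto
  have \<Gamma>_cont: "continuous_on {0..} \<Gamma>"
    by (rule DERIV_continuous_on[OF \<Gamma>'(1)]) simp
  have "\<exists>k::nat. integral {real n..real n + 1} (\<lambda>t. \<Gamma> t * exp (- (real k * (sin (pi * t))\<^sup>2))) < a n" for n
    by (rule thin_spike_integral[OF \<Gamma>_cont _ a]) (use \<Gamma> in \<open>auto intro: less_imp_le\<close>)
  then obtain m :: "nat \<Rightarrow> nat" where
    m: "\<And>n. integral {real n..real n + 1} (\<lambda>t. \<Gamma> t * exp (- (real (m n) * (sin (pi * t))\<^sup>2))) < a n"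
    by metis
  obtain M M' where M': "\<And>t. 0 \<le> t \<Longrightarrow> (M has_real_derivative M' t) (at t)" "continuous_on {0..} M'"
    and M: "\<And>n t. real n \<le> t \<Longrightarrow> real (m n) \<le> M t"
    using C1_majorant_of_sequence[of "\<lambda>n. real (m n)"] by blast
  have M_cont: "continuous_on {0..} M"
    by (rule DERIV_continuous_on[OF has_field_derivative_at_within[OF M'(1)]]) simp
  define p where "p t = exp (- (M t * (sin (pi * t))\<^sup>2))" for t
  define p' where "p' t = p t * - (M' t * (sin (pi * t))\<^sup>2 + M t * (2 * sin (pi * t) * (cos (pi * t) * pi)))" for t
  have p_cont: "continuous_on {0..} p"
    unfolding p_def by (intro continuous_intros M_cont)
  have p'_cont: "continuous_on {0..} p'"
    unfolding p'_def by (intro continuous_intros M_cont M' p_cont)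
  have p': "(p has_real_derivative p' t) (at t)" if "0 \<le> t" for t
    unfolding p_def[abs_def] p'_def
    by (rule derivative_eq_intros refl M' that | simp)+
  have p_pos: "p t > 0" for t
    by (simp add: p_def)
  have p_le_1: "p t \<le> 1" if "0 \<le> t" for t
    using M[of 0 t] that by (simp add: p_def)
  have p_nat: "p (real n) = 1" for n
    by (simp add: p_def mult.commute[of pi])
  define g where "g t = \<Gamma> t * p t" for t
  have g_cont: "continuous_on {0..} g"
    unfolding g_def by (intro continuous_intros \<Gamma>_cont p_cont)
  have g_pos: "g t > 0" if "0 \<le> t" for t
    using \<Gamma>[OF that] p_pos[of t] by (simp add: g_def)
  show thesis
  proof (rule that[OF _ g_cont g_pos])
    have "(g has_real_derivative \<Gamma>' t * p t + p' t * \<Gamma> t) (at t within {0<..})" if "t \<in> {0<..}" for t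
      unfolding g_def[abs_def]
      by (rule DERIV_mult[OF DERIV_subset[OF \<Gamma>'(1)] has_field_derivative_at_within[OF p']])
         (use that in auto)
    moreover have "continuous_on {0<..} (\<lambda>t. \<Gamma>' t * p t + p' t * \<Gamma> t)"
      by (rule continuous_on_subset[of "{0..}"])
         (auto intro!: continuous_intros \<Gamma>' p'_cont p_cont \<Gamma>_cont)
    ultimately show "g \<in> C1_maps {0<..} {0<..}"
      unfolding C1_maps_def using g_pos
      by (auto intro!: exI[of _ "\<lambda>t. \<Gamma>' t * p t + p' t * \<Gamma> t"])
  next
    have ratio: "\<bar>g t\<bar> / \<Gamma> t = p t" if "0 \<le> t" for t
      using \<Gamma>[OF that] p_pos[of t] by (simp add: g_def abs_mult)
    show "Limsup at_top (\<lambda>t. ereal (\<bar>g t\<bar> / \<Gamma> t)) = 1"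
    proof (rule antisym)
      show "Limsup at_top (\<lambda>t. ereal (\<bar>g t\<bar> / \<Gamma> t)) \<le> 1"
        by (rule Limsup_bounded, rule eventually_mono[OF eventually_ge_at_top[of 0]])
           (simp add: ratio p_le_1)
      show "1 \<le> Limsup at_top (\<lambda>t. ereal (\<bar>g t\<bar> / \<Gamma> t))"
      proof (rule ccontr)
        assume "\<not> 1 \<le> Limsup at_top (\<lambda>t. ereal (\<bar>g t\<bar> / \<Gamma> t))"
        then have "\<forall>\<^sub>F t in at_top. ereal (\<bar>g t\<bar> / \<Gamma> t) < 1"
          by (intro Limsup_lessD) simp
        then have "\<forall>\<^sub>F n in sequentially. ereal (\<bar>g (real n)\<bar> / \<Gamma> (real n)) < 1"
          using eventually_compose_filterlim filterlim_real_sequentially by blast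
        then show False
          by (simp add: ratio p_nat)
      qed
    qed
  next
    fix n
    have "integral {real n..real n + 1} g
        \<le> integral {real n..real n + 1} (\<lambda>t. \<Gamma> t * exp (- (real (m n) * (sin (pi * t))\<^sup>2)))"
    proof (rule integral_le)
      show "g integrable_on {real n..real n + 1}"
        by (intro integrable_continuous_real continuous_on_subset[OF g_cont]) auto
      show "(\<lambda>t. \<Gamma> t * exp (- (real (m n) * (sin (pi * t))\<^sup>2))) integrable_on {real n..real n + 1}"
        by (intro integrable_continuous_real continuous_intros continuous_on_subset[OF \<Gamma>_cont]) auto
      show "g t \<le> \<Gamma> t * exp (- (real (m n) * (sin (pi * t))\<^sup>2))" if "t \<in> {real n..real n + 1}" for t
        unfolding g_def p_def using M[of n t] \<Gamma>[of t] that
        by (auto intro!: mult_left_mono mult_right_mono)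
    qed
    with m[of n] show "integral {real n..real n + 1} g \<le> a n" by simp
  qed
qed

text \<open>
  The masses in \<open>{k..k + 1}\<close> for \<open>k \<ge> n\<close> are at most \<open>\<delta> n / 2 ^ Suc k\<close>, because the minimum runs over all
  indices up to \<open>k\<close>; summing the geometric series bounds the tail from \<open>n\<close> on by \<open>\<delta> n\<close>.
\<close>
lemma tail_integral_below_sequence:
  fixes g :: "real \<Rightarrow> real" and \<delta> :: "nat \<Rightarrow> real"
  assumes cont: "continuous_on {0..} g" and pos: "\<And>t. 0 \<le> t \<Longrightarrow> 0 < g t" and \<delta>: "\<And>n. \<delta> n > 0"
    and mass: "\<And>n. integral {real n..real n + 1} g \<le> Min (\<delta> ` {..n}) / 2 ^ Suc n"
  obtains G :: "real \<Rightarrow> real" and L :: real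
  where "((\<lambda>t::real. LBINT s=0..t. g s) \<longlongrightarrow> L) at_top"
    "\<And>t. 0 < t \<Longrightarrow> (LBINT s=t..\<infinity>. g s) = G t"
    "\<And>t. 0 < t \<Longrightarrow> (G has_real_derivative - g t) (at t)"
    "\<And>t. 0 < t \<Longrightarrow> 0 < G t" "(G \<longlongrightarrow> 0) at_top"
    "\<And>n t. real n \<le> t \<Longrightarrow> G t \<le> \<delta> n"
proof -
  define P where "P t = integral {0..t} g" for t
  have int: "g integrable_on {a..b}" if "0 \<le> a" for a b
    by (intro integrable_continuous_real continuous_on_subset[OF cont]) (use that in auto)
  have P': "(P has_real_derivative g t) (at t)" if "0 < t" for t
  proof -
    have "(P has_real_derivative g t) (at t within {0..t + 1})"
      unfolding P_def
      by (intro integral_has_real_derivative continuous_on_subset[OF cont]) (use that in auto)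
    then show ?thesis
      using that by (simp add: at_within_Icc_at)
  qed
  have P_mono: "P s \<le> P t" if "0 \<le> s" "s \<le> t" for s t
    unfolding P_def
    by (intro integral_subset_le int) (use that pos in \<open>auto intro: less_imp_le\<close>)
  have P_strict: "P s < P t" if "0 < s" "s < t" for s t
  proof (rule DERIV_pos_imp_increasing[OF that(2)])
    show "\<exists>y. (P has_real_derivative y) (at r) \<and> 0 < y" if "s \<le> r" for r
      using P'[of r] pos[of r] that \<open>0 < s\<close> by (intro exI[of _ "g r"]) auto
  qed
  have step: "P (real k + 1) \<le> P (real k) + \<delta> n / 2 ^ Suc k" if "n \<le> k" for n k
  proof -
    have "P (real k + 1) = P (real k) + integral {real k..real k + 1} g"
      unfolding P_def by (rule Henstock_Kurzweil_Integration.integral_combine[symmetric]) (auto intro: int)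
    moreover have "Min (\<delta> ` {..k}) / 2 ^ Suc k \<le> \<delta> n / 2 ^ Suc k"
      by (intro divide_right_mono Min_le) (use that in auto)
    ultimately show ?thesis
      using mass[of k] by linarith
  qed
  have "P (real (n + j)) \<le> P (real n) + \<delta> n * (1 - 1 / 2 ^ j)" for n j
  proof (induction j)
    case (Suc j)
    have "P (real (n + Suc j)) \<le> P (real (n + j)) + \<delta> n / 2 ^ Suc (n + j)"
      using step[of n "n + j"] by (simp add: add_ac)
    also have "\<dots> \<le> P (real (n + j)) + \<delta> n / 2 ^ Suc j"
      using \<delta>[of n] by (intro add_left_mono divide_left_mono power_increasing) auto
    also have "\<dots> \<le> P (real n) + \<delta> n * (1 - 1 / 2 ^ j) + \<delta> n / 2 ^ Suc j"
      using Suc by simp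
    also have "\<dots> = P (real n) + \<delta> n * (1 - 1 / 2 ^ Suc j)"
      by (simp add: field_simps)
    finally show ?case .
  qed simp
  moreover have "\<delta> n * (1 - 1 / 2 ^ j) \<le> \<delta> n" for n j
    using \<delta>[of n] by (intro mult_left_le) auto
  ultimately have P_bound': "P (real (n + j)) \<le> P (real n) + \<delta> n" for n j
    by (meson add_left_mono order_trans)
  have P_bound: "P t \<le> P (real n) + \<delta> n" if "0 \<le> t" for n t
  proof -
    have "P t \<le> P (real (n + nat \<lceil>t\<rceil>))"
      using that by (intro P_mono) linarith+
    then show ?thesis using P_bound'[of n "nat \<lceil>t\<rceil>"] by linarith
  qed
  from mono_bounded_tendsto_at_top[of 0 P, OF P_mono P_bound]
  obtain L where L: "(P \<longlongrightarrow> L) at_top" "\<And>t. 0 \<le> t \<Longrightarrow> P t \<le> L" by blast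
  have L_bound: "L \<le> P (real n) + \<delta> n" for n
    by (rule tendsto_upperbound[OF L(1)])
       (auto intro: eventually_mono[OF eventually_ge_at_top[of 0]] P_bound)
  show thesis
  proof (rule that[of L "\<lambda>t. L - P t"])
    have "(LBINT s=0..t. g s) = P t" if "0 \<le> t" for t
    proof -
      have "set_integrable lborel {0..t} g"
        by (intro borel_integrable_atLeastAtMost' continuous_on_subset[OF cont]) auto
      from interval_integral_eq_integral[OF that this] show ?thesis
        by (simp add: P_def zero_ereal_def)
    qed
    then have "\<forall>\<^sub>F t in at_top. P t = (LBINT s=0..t. g s)"
      by (auto intro: eventually_mono[OF eventually_ge_at_top[of 0]])
    then show "((\<lambda>t::real. LBINT s=0..t. g s) \<longlongrightarrow> L) at_top"
      by (rule Lim_transform_eventually[OF L(1)])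
    show "(LBINT s=t..\<infinity>. g s) = L - P t" if "0 < t" for t
    proof (rule interval_integral_FTC_nonneg(2)[of "ereal t" \<infinity> P])
      show "isCont g s" if s: "ereal t < ereal s" for s
        by (rule continuous_on_interior[OF cont]) (use s \<open>0 < t\<close> in simp)
      show "((P \<circ> real_of_ereal) \<longlongrightarrow> P t) (at_right (ereal t))"
        unfolding ereal_tendsto_simps1 using DERIV_isCont[OF P'[OF that]]
        by (simp add: isCont_def filterlim_at_split)
      show "((P \<circ> real_of_ereal) \<longlongrightarrow> L) (at_left \<infinity>)"
        unfolding ereal_tendsto_simps1 by (rule L)
      show "(P has_real_derivative g s) (at s)" if "ereal t < ereal s" for s
        using P'[of s] that \<open>0 < t\<close> by simp
      show "AE s in lborel. ereal t < ereal s \<longrightarrow> ereal s < \<infinity> \<longrightarrow> 0 \<le> g s"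
        using pos \<open>0 < t\<close> by (intro AE_I2) (simp add: less_imp_le)
    qed simp
    show "((\<lambda>t. L - P t) has_real_derivative - g t) (at t)" if "0 < t" for t
      using P'[OF that] by (auto intro!: derivative_eq_intros)
    show "0 < L - P t" if "0 < t" for t
      using P_strict[of t "t + 1"] L(2)[of "t + 1"] that by simp
    have "((\<lambda>t. L - P t) \<longlongrightarrow> L - L) at_top"
      by (intro tendsto_intros L)
    then show "((\<lambda>t. L - P t) \<longlongrightarrow> 0) at_top" by simp
    show "L - P t \<le> \<delta> n" if "real n \<le> t" for n t
      using L_bound[of n] P_mono[of "real n" t] that by simp
  qed
qed

section \<open>The decay rate of the unforced equation\<close>

locale decay_rate =
  fixes f :: "real \<Rightarrow> real"
  assumes cont: "continuous_on {0<..} f"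
    and pos: "x > 0 \<Longrightarrow> f x > 0"
    and sublinear: "((\<lambda>x. f x / x) \<longlongrightarrow> 0) (at_right 0)"
begin

abbreviation "F \<equiv> F_fun f"

lemma F_has_derivative:
  assumes "x > 0"
  shows "(F has_real_derivative - (1 / f x)) (at x)"
proof -
  define a b where "a = min x 1 / 2" and "b = max x 1 + 1"
  have ab: "0 < a" "a < x" "x < b" "a \<le> 1" "1 \<le> b"
    using assms by (auto simp: a_def b_def min_def max_def)
  have "continuous_on {a..b} (\<lambda>u. 1 / f u)"
  proof (intro continuous_on_divide continuous_on_const ballI)
    show "continuous_on {a..b} f"
      by (rule continuous_on_subset[OF cont]) (use ab in auto)
    show "f u \<noteq> 0" if "u \<in> {a..b}" for u
      using pos[of u] that ab by auto
  qed
  from interval_integral_FTC2[OF ab(4,5) this, of x] ab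
  have "((\<lambda>u. LBINT y=1..u. 1 / f y) has_vector_derivative 1 / f x) (at x within {a..b})"
    by (simp add: one_ereal_def)
  then have "((\<lambda>u. LBINT y=1..u. 1 / f y) has_real_derivative 1 / f x) (at x)"
    using ab by (simp add: has_real_derivative_iff_has_vector_derivative at_within_Icc_at)
  moreover have "F = (\<lambda>u. - (LBINT y=1..u. 1 / f y))"
    unfolding F_fun_def by (subst interval_integral_endpoints_reverse) simp
  ultimately show ?thesis
    by (simp add: DERIV_minus)
qed

lemma F_strict_antimono:
  assumes "0 < x" "x < y"
  shows "F y < F x"
proof (rule DERIV_neg_imp_decreasing[OF assms(2)])
  show "\<exists>d. (F has_real_derivative d) (at u) \<and> d < 0" if "x \<le> u" "u \<le> y" for u
    using F_has_derivative[of u] pos[of u] assms that by (intro exI[of _ "- (1 / f u)"]) auto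
qed

lemma F_less_iff:
  assumes "0 < x" "0 < y"
  shows "F x < F y \<longleftrightarrow> y < x"
  using F_strict_antimono[of x y] F_strict_antimono[of y x] assms
  by (metis less_asym linorder_neqE_linordered_idom)

lemma F_one: "F 1 = 0"
  unfolding F_fun_def one_ereal_def by (rule interval_integral_endpoints_same)

text \<open>
  Near \<open>0\<close> sublinearity gives \<open>f u < u\<close>, so \<open>F + ln\<close> is decreasing there and \<open>F\<close> grows at least like
  \<open>- ln\<close>.
\<close>
lemma F_at_top: "filterlim F at_top (at_right 0)"
proof -
  have "\<forall>\<^sub>F x in at_right 0. f x / x < 1"
    using sublinear by (rule order_tendstoD) simp
  then obtain d where d: "d > 0" "\<And>x. 0 < x \<Longrightarrow> x < d \<Longrightarrow> f x / x < 1"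
    unfolding eventually_at_right_field by auto
  define e where "e = d / 2"
  have e: "e > 0" "e < d"
    using d by (auto simp: e_def)
  have bound: "F x \<ge> (F e + ln e) + - ln x" if x: "0 < x" "x < e" for x
  proof -
    have "F e + ln e \<le> F x + ln x"
    proof (rule DERIV_nonpos_imp_nonincreasing[where f = "\<lambda>u. F u + ln u"])
      show "x \<le> e" using x by simp
      show "\<exists>D. ((\<lambda>u. F u + ln u) has_real_derivative D) (at u) \<and> D \<le> 0"
        if u: "x \<le> u" "u \<le> e" for u
      proof (intro exI conjI)
        show "((\<lambda>u. F u + ln u) has_real_derivative - (1 / f u) + 1 / u) (at u)"
          using u x by (auto intro!: derivative_eq_intros F_has_derivative)
        have "f u < u"
          using d(2)[of u] u x e by (simp add: divide_simps)
        then show "- (1 / f u) + 1 / u \<le> 0"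
          using pos[of u] u x by (simp add: divide_simps)
      qed
    qed
    then show ?thesis by simp
  qed
  have "filterlim (\<lambda>x::real. - ln x) at_top (at_right 0)"
    using ln_at_0 by (simp add: filterlim_uminus_at_bot)
  then have "filterlim (\<lambda>x::real. (F e + ln e) + - ln x) at_top (at_right 0)"
    by (rule filterlim_tendsto_add_at_top[OF tendsto_const])
  moreover have "\<forall>\<^sub>F x in at_right 0. (F e + ln e) + - ln x \<le> F x"
    using bound e by (auto simp: eventually_at_right_field intro!: exI[of _ e])
  ultimately show ?thesis
    by (rule filterlim_at_top_mono)
qed

lemma F_surj:
  assumes "t \<ge> 0"
  shows "\<exists>x>0. F x = t"
proof -
  have "\<forall>\<^sub>F x in at_right 0. t \<le> F x"
    using F_at_top by (simp add: filterlim_at_top)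
  moreover have "\<forall>\<^sub>F x in at_right (0::real). 0 < x \<and> x < 1"
    by (auto simp: eventually_at_right_field intro: exI[of _ 1])
  ultimately have "\<forall>\<^sub>F x in at_right 0. t \<le> F x \<and> 0 < x \<and> x < 1"
    by eventually_elim auto
  then obtain a where a: "t \<le> F a" "0 < a" "a < 1"
    using eventually_happens'[OF trivial_limit_at_right_real] by blast
  have "\<exists>x\<ge>a. x \<le> 1 \<and> F x = t"
  proof (rule IVT2')
    show "continuous_on {a..1} F"
      by (rule DERIV_continuous_on[OF has_field_derivative_at_within[OF F_has_derivative]])
         (use a in auto)
  qed (use a assms F_one in auto)
  then show ?thesis using a by (metis less_le_trans)
qed

lemma F_inv_inverse:
  assumes "t \<ge> 0"
  shows F_inv_pos: "F_inv f t > 0" and F_F_inv: "F (F_inv f t) = t"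
proof -
  have t: "t \<in> F ` {0<..}"
    using F_surj[OF assms] by auto
  show "F_inv f t > 0"
    using inv_into_into[OF t] by (simp add: F_inv_def)
  show "F (F_inv f t) = t"
    using f_inv_into_f[OF t] by (simp add: F_inv_def)
qed

text \<open>
  This adjunction translates every bound on \<open>F v\<close> into a bound on \<open>v\<close>, and conversely.
\<close>
lemma F_le_iff:
  assumes "v > 0" "t \<ge> 0"
  shows "F v \<le> t \<longleftrightarrow> F_inv f t \<le> v"
  using F_less_iff[of "F_inv f t" v] F_inv_inverse[OF assms(2)] assms by (simp add: not_less[symmetric])

lemma F_inv_antimono:
  assumes "0 \<le> s" "s \<le> t"
  shows "F_inv f t \<le> F_inv f s"
  using assms F_le_iff[of "F_inv f s" t] F_inv_inverse[of s] by simp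

lemma F_inv_tendsto_0: "filterlim (F_inv f) (at_right 0) at_top"
proof (rule tendsto_imp_filterlim_at_right)
  show "\<forall>\<^sub>F t in at_top. F_inv f t > 0"
    using eventually_ge_at_top[of 0] by eventually_elim (rule F_inv_pos)
  show "(F_inv f \<longlongrightarrow> 0) at_top"
  proof (rule order_tendstoI)
    fix a :: real assume "a < 0"
    with F_inv_pos show "\<forall>\<^sub>F t in at_top. a < F_inv f t"
      by (intro eventually_mono[OF eventually_ge_at_top[of 0]]) (metis less_trans)
  next
    fix a :: real assume "0 < a"
    show "\<forall>\<^sub>F t in at_top. F_inv f t < a"
      using eventually_ge_at_top[of 0] eventually_gt_at_top[of "F a"]
    proof eventually_elim
      case (elim t)
      then show ?case
        using F_less_iff[of a "F_inv f t"] F_inv_inverse[of t] \<open>0 < a\<close> by simp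
    qed
  qed
qed

end

locale regularly_varying_decay = decay_rate f for f +
  fixes \<beta> :: real
  assumes \<beta>: "\<beta> > 1"
    and RV: "c > 0 \<Longrightarrow> ((\<lambda>x. f (c * x) / f x) \<longlongrightarrow> c powr \<beta>) (at_right 0)"
begin

text \<open>
  \<open>F\<close> blows up at \<open>0\<close>, so L'Hopital's rule reduces the claim to the quotient of the derivatives
  \<open>c / f (c * x)\<close> and \<open>1 / f x\<close>, that is, to the regular variation of \<open>f\<close>.
\<close>
lemma F_regularly_varying:
  assumes c: "c > 0"
  shows "((\<lambda>x. F (c * x) / F x) \<longlongrightarrow> c powr (1 - \<beta>)) (at_right 0)"
proof (rule lhopital_right_0_at_top[where f' = "\<lambda>x. - (1 / f (c * x)) * c" and g' = "\<lambda>x. - (1 / f x)"])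
  have p: "\<forall>\<^sub>F x in at_right (0::real). 0 < x"
    by (simp add: eventually_at_right_less)
  show "filterlim F at_top (at_right 0)" by (rule F_at_top)
  show "\<forall>\<^sub>F x in at_right 0. - (1 / f x) \<noteq> 0"
    using p by eventually_elim (use pos in force)
  show "\<forall>\<^sub>F x in at_right 0. (F has_real_derivative - (1 / f x)) (at x)"
    using p by eventually_elim (rule F_has_derivative)
  show "\<forall>\<^sub>F x in at_right 0. ((\<lambda>x. F (c * x)) has_real_derivative - (1 / f (c * x)) * c) (at x)"
    using p
  proof eventually_elim
    case (elim x)
    show ?case
      by (rule DERIV_chain2[OF F_has_derivative]) (use elim c in \<open>auto intro!: derivative_eq_intros\<close>)
  qed
  have "((\<lambda>x. c / (f (c * x) / f x)) \<longlongrightarrow> c / c powr \<beta>) (at_right 0)"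
    by (intro tendsto_intros RV c) (use c in auto)
  moreover have "c / c powr \<beta> = c powr (1 - \<beta>)"
    using c by (simp add: powr_diff)
  ultimately show "((\<lambda>x. - (1 / f (c * x)) * c / - (1 / f x)) \<longlongrightarrow> c powr (1 - \<beta>)) (at_right 0)"
    by (simp add: field_simps)
qed

lemma F_F_inv_ratio:
  assumes "c > 0"
  shows "((\<lambda>t. F (c * F_inv f t) / t) \<longlongrightarrow> c powr (1 - \<beta>)) at_top"
proof (rule Lim_transform_eventually)
  show "((\<lambda>t. F (c * F_inv f t) / F (F_inv f t)) \<longlongrightarrow> c powr (1 - \<beta>)) at_top"
    using filterlim_compose[OF F_regularly_varying[OF assms] F_inv_tendsto_0] .
  show "\<forall>\<^sub>F t in at_top. F (c * F_inv f t) / F (F_inv f t) = F (c * F_inv f t) / t"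
    using eventually_ge_at_top[of 0] by eventually_elim (simp add: F_F_inv)
qed

text \<open>
  As \<open>F\<close> is decreasing, \<open>v < c * F_inv f t\<close> means \<open>F (c * F_inv f t) < F (v t)\<close>, and the left-hand side
  divided by \<open>t\<close> tends to \<open>c powr (1 - \<beta>)\<close>.
\<close>
lemma eventually_below_multiple_of_F_inv:
  assumes c: "c > 0" and v: "\<forall>\<^sub>F t in at_top. v t > 0"
    and q: "\<forall>\<^sub>F t in at_top. F (v t) / t > q" "c powr (1 - \<beta>) < q"
  shows "\<forall>\<^sub>F t in at_top. v t / F_inv f t < c"
  using order_tendstoD(2)[OF F_F_inv_ratio[OF c] q(2)] q(1) v eventually_gt_at_top[of 0]
proof eventually_elim
  case (elim t)
  have "F_inv f t > 0"
    using elim by (simp add: F_inv_pos)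
  have "F (c * F_inv f t) / t < F (v t) / t"
    using elim by linarith
  then have "F (c * F_inv f t) < F (v t)"
    using elim by (simp add: divide_less_cancel)
  then have "v t < c * F_inv f t"
    using F_less_iff \<open>F_inv f t > 0\<close> c elim by simp
  then show ?case
    using \<open>F_inv f t > 0\<close> by (simp add: divide_less_eq)
qed

lemma eventually_above_multiple_of_F_inv:
  assumes c: "c > 0" and v: "\<forall>\<^sub>F t in at_top. v t > 0"
    and q: "\<forall>\<^sub>F t in at_top. F (v t) / t < q" "q < c powr (1 - \<beta>)"
  shows "\<forall>\<^sub>F t in at_top. c < v t / F_inv f t"
  using order_tendstoD(1)[OF F_F_inv_ratio[OF c] q(2)] q(1) v eventually_gt_at_top[of 0]
proof eventually_elim
  case (elim t)
  have "F_inv f t > 0"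
    using elim by (simp add: F_inv_pos)
  have "F (v t) / t < F (c * F_inv f t) / t"
    using elim by linarith
  then have "F (v t) < F (c * F_inv f t)"
    using elim by (simp add: divide_less_cancel)
  then have "c * F_inv f t < v t"
    using F_less_iff \<open>F_inv f t > 0\<close> c elim by simp
  then show ?case
    using \<open>F_inv f t > 0\<close> by (simp add: less_divide_eq)
qed

text \<open>
  Here \<open>\<beta> > 1\<close> is essential: \<open>c powr (1 - \<beta>)\<close> lies strictly below \<open>1\<close> for \<open>c > 1\<close> and strictly above
  \<open>1\<close> for \<open>c < 1\<close>, so the limit \<open>1\<close> of \<open>F (v t) / t\<close> separates \<open>v / F_inv f\<close> from every such \<open>c\<close>.
\<close>
lemma asymptotic_to_F_inv:
  assumes v: "\<forall>\<^sub>F t in at_top. v t > 0" and lim: "((\<lambda>t. F (v t) / t) \<longlongrightarrow> 1) at_top"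
  shows "((\<lambda>t. v t / F_inv f t) \<longlongrightarrow> 1) at_top"
proof (rule order_tendstoI)
  fix c :: real assume c: "1 < c"
  then have "c powr (1 - \<beta>) < 1"
    using powr_less_mono[of "1 - \<beta>" 0 c] \<beta> by simp
  then obtain q where q: "c powr (1 - \<beta>) < q" "q < 1"
    using dense by blast
  show "\<forall>\<^sub>F t in at_top. v t / F_inv f t < c"
    by (rule eventually_below_multiple_of_F_inv[OF _ v order_tendstoD(1)[OF lim q(2)] q(1)])
       (use c in simp)
next
  fix c :: real assume c: "c < 1"
  define d where "d = max c (1/2)"
  have d: "0 < d" "d < 1" "c \<le> d"
    using c by (auto simp: d_def)
  then have "1 < d powr (1 - \<beta>)"
    using powr_less_mono'[of d "1 - \<beta>" 0] \<beta> by simp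
  then obtain q where q: "1 < q" "q < d powr (1 - \<beta>)"
    using dense by blast
  have "\<forall>\<^sub>F t in at_top. d < v t / F_inv f t"
    by (rule eventually_above_multiple_of_F_inv[OF d(1) v order_tendstoD(2)[OF lim q(1)] q(2)])
  then show "\<forall>\<^sub>F t in at_top. c < v t / F_inv f t"
    by eventually_elim (use d in linarith)
qed

text \<open>
  Now \<open>F (v t) / t\<close> exceeds every bound, hence \<open>c powr (1 - \<beta>)\<close> for every \<open>c > 0\<close>.
\<close>
lemma negligible_against_F_inv:
  assumes v: "\<forall>\<^sub>F t in at_top. v t > 0" and big: "\<forall>\<^sub>F t in at_top. F (v t) > t\<^sup>2"
  shows "((\<lambda>t. v t / F_inv f t) \<longlongrightarrow> 0) at_top"
proof (rule order_tendstoI)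
  fix c :: real assume "c < 0"
  show "\<forall>\<^sub>F t in at_top. c < v t / F_inv f t"
    using v eventually_ge_at_top[of 0]
    by eventually_elim (use \<open>c < 0\<close> F_inv_pos in \<open>auto intro: less_trans\<close>)
next
  fix c :: real assume c: "0 < c"
  have "\<forall>\<^sub>F t in at_top. F (v t) / t > c powr (1 - \<beta>) + 1"
    using big eventually_gt_at_top[of "c powr (1 - \<beta>) + 1"] eventually_gt_at_top[of 0]
  proof eventually_elim
    case (elim t)
    then have "t < F (v t) / t"
      by (simp add: less_divide_eq power2_eq_square)
    with elim show ?case by linarith
  qed
  then show "\<forall>\<^sub>F t in at_top. v t / F_inv f t < c"
    by (rule eventually_below_multiple_of_F_inv[OF c v]) simp
qed

section \<open>Asymptotics of the forced equation\<close>

text \<open>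
  With \<open>v = \<sigma> * (x + G)\<close>, the derivative of \<open>F (v t)\<close> is \<open>r t = \<sigma> * f (x t) / f (v t)\<close>. It is compared
  with \<open>q (v t)\<close>, where \<open>q u = \<sigma> * f (\<sigma> * u) / f u\<close> tends to \<open>1\<close> at \<open>0\<close> for either sign; the error made in
  replacing \<open>x = \<sigma> * v - G\<close> by \<open>\<sigma> * v\<close> is what \<open>f_shift\<close> controls, as long as \<open>v\<close> is at least
  \<open>F_inv f (t^2)\<close>. The growth dichotomy then decides between the limits \<open>0\<close> and \<open>\<sigma>\<close>.
\<close>
lemma solution_trichotomy:
  fixes g G x :: "real \<Rightarrow> real"
  assumes f_cont: "continuous_on UNIV f" and f0: "f 0 = 0" and f_sign: "\<And>u. u \<noteq> 0 \<Longrightarrow> u * f u > 0"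
    and f_odd: "((\<lambda>u. - f (- u) / f u) \<longlongrightarrow> 1) (at_right 0)"
    and g: "\<And>t. t > 0 \<Longrightarrow> g t > 0"
    and G': "\<And>t. t > 0 \<Longrightarrow> (G has_real_derivative - g t) (at t)"
    and G_pos: "\<And>t. t > 0 \<Longrightarrow> G t > 0" and G_lim: "(G \<longlongrightarrow> 0) at_top"
    and G_small: "((\<lambda>t. G t / F_inv f t) \<longlongrightarrow> 0) at_top"
    and f_shift: "\<And>t u. t > 0 \<Longrightarrow> F_inv f (t\<^sup>2) \<le> \<bar>u\<bar> \<Longrightarrow> \<bar>u\<bar> \<le> 1 \<Longrightarrow> \<bar>f (u - G t) - f u\<bar> \<le> \<bar>f u\<bar> / t"
    and x: "\<And>t. t > 0 \<Longrightarrow> (x has_real_derivative - f (x t) + g t) (at t)"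
  shows "\<exists>c\<in>{-1, 0, 1}. ((\<lambda>t. x t / F_inv f t) \<longlongrightarrow> c) at_top"
proof -
  obtain \<sigma> :: real where \<sigma>: "\<sigma> \<in> {-1, 1}"
    and sign: "\<forall>\<^sub>F t in at_top. \<sigma> * (x t + G t) > 0" and lim: "((\<lambda>t. x t + G t) \<longlongrightarrow> 0) at_top"
    using eventual_sign_and_decay[OF f_cont f_sign f0 g G' G_pos G_lim x] by blast
  have \<sigma>2: "\<sigma> * (\<sigma> * a) = a" for a
    using \<sigma> by auto
  define v where "v t = \<sigma> * (x t + G t)" for t
  have v_pos: "\<forall>\<^sub>F t in at_top. v t > 0"
    using sign by (simp add: v_def)
  have "(v \<longlongrightarrow> 0) at_top"
    unfolding v_def using tendsto_mult_left[OF lim, of \<sigma>] by simp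
  then have v0: "filterlim v (at_right 0) at_top"
    using v_pos by (rule tendsto_imp_filterlim_at_right)
  have x_eq: "x t = \<sigma> * v t - G t" for t
    by (simp add: v_def \<sigma>2)
  define q where "q u = \<sigma> * f (\<sigma> * u) / f u" for u
  have "(q \<longlongrightarrow> 1) (at_right 0)"
  proof (cases "\<sigma> = 1")
    case True
    have "\<forall>\<^sub>F u in at_right (0::real). 0 < u"
      by (simp add: eventually_at_right_less)
    then have "\<forall>\<^sub>F u in at_right 0. q u = 1"
      by eventually_elim (use pos True in \<open>force simp: q_def\<close>)
    then show ?thesis by (rule tendsto_eventually)
  next
    case False
    with \<sigma> f_odd show ?thesis by (simp add: q_def[abs_def])
  qed
  then have q: "((\<lambda>t. q (v t)) \<longlongrightarrow> 1) at_top"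
    by (rule filterlim_compose[OF _ v0])
  define r where "r t = \<sigma> * f (x t) / f (v t)" for t
  have "\<forall>\<^sub>F t in at_top. ((\<lambda>t. F (v t)) has_real_derivative r t) (at t)"
    using v_pos eventually_gt_at_top[of 0]
  proof eventually_elim
    case (elim t)
    have "(v has_real_derivative \<sigma> * (- f (x t) + g t + - g t)) (at t)"
      unfolding v_def by (intro DERIV_cmult DERIV_add x G') (use elim in auto)
    from DERIV_chain2[OF F_has_derivative this] elim show ?case
      by (simp add: r_def)
  qed
  moreover have "\<forall>\<^sub>F t in at_top. F (v t) \<le> t\<^sup>2 \<longrightarrow> \<bar>r t - 1\<bar> < e" if "e > 0" for e
  proof -
    have "((\<lambda>t. \<bar>q (v t) - 1\<bar> + \<bar>q (v t)\<bar> * (1 / t)) \<longlongrightarrow> \<bar>1 - 1\<bar> + \<bar>1\<bar> * 0) at_top"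
      by (intro tendsto_intros q tendsto_divide_0[OF tendsto_const] filterlim_at_top_imp_at_infinity
          filterlim_ident)
    then have "\<forall>\<^sub>F t in at_top. \<bar>q (v t) - 1\<bar> + \<bar>q (v t)\<bar> * (1 / t) < e"
      using that by (intro order_tendstoD(2)) auto
    moreover have "\<forall>\<^sub>F t in at_top. v t < 1"
      by (rule order_tendstoD(2)[OF \<open>(v \<longlongrightarrow> 0) at_top\<close>]) simp
    ultimately show ?thesis
      using v_pos eventually_gt_at_top[of 0]
    proof eventually_elim
      case (elim t)
      show ?case
      proof
        assume "F (v t) \<le> t\<^sup>2"
        then have "F_inv f (t\<^sup>2) \<le> v t"
          using F_le_iff[of "v t" "t\<^sup>2"] elim by simp
        moreover have "\<bar>\<sigma> * v t\<bar> = v t"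
          using \<sigma> elim by auto
        ultimately have "\<bar>f (x t) - f (\<sigma> * v t)\<bar> \<le> \<bar>f (\<sigma> * v t)\<bar> / t"
          using f_shift[of t "\<sigma> * v t"] elim by (simp add: x_eq)
        then have "\<bar>f (x t) - f (\<sigma> * v t)\<bar> / f (v t) \<le> \<bar>f (\<sigma> * v t)\<bar> / t / f (v t)"
          using pos[of "v t"] elim by (intro divide_right_mono) auto
        moreover have "\<bar>r t - q (v t)\<bar> = \<bar>f (x t) - f (\<sigma> * v t)\<bar> / f (v t)"
          using \<sigma> pos[of "v t"] elim
          by (auto simp: r_def q_def abs_divide simp flip: diff_divide_distrib)
        moreover have "\<bar>f (\<sigma> * v t)\<bar> / t / f (v t) = \<bar>q (v t)\<bar> * (1 / t)"
          using \<sigma> pos[of "v t"] elim by (auto simp: q_def abs_divide)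
        ultimately show "\<bar>r t - 1\<bar> < e"
          using elim by linarith
      qed
    qed
  qed
  ultimately have cases: "(\<forall>\<^sub>F t in at_top. F (v t) > t\<^sup>2) \<or> ((\<lambda>t. F (v t) / t) \<longlongrightarrow> 1) at_top"
    by (rule growth_dichotomy)
  have transfer: "((\<lambda>t. x t / F_inv f t) \<longlongrightarrow> \<sigma> * l) at_top" if "((\<lambda>t. v t / F_inv f t) \<longlongrightarrow> l) at_top" for l
  proof -
    have "((\<lambda>t. \<sigma> * (v t / F_inv f t) - G t / F_inv f t) \<longlongrightarrow> \<sigma> * l - 0) at_top"
      by (intro tendsto_intros that G_small)
    then show ?thesis
      by (simp add: x_eq diff_divide_distrib)
  qed
  from cases show ?thesis
  proof
    assume "\<forall>\<^sub>F t in at_top. F (v t) > t\<^sup>2"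
    from transfer[OF negligible_against_F_inv[OF v_pos this]] show ?thesis by auto
  next
    assume "((\<lambda>t. F (v t) / t) \<longlongrightarrow> 1) at_top"
    from transfer[OF asymptotic_to_F_inv[OF v_pos this]] \<sigma> show ?thesis by auto
  qed
qed

end

theorem theorem17:
  fixes f \<Gamma> :: "real \<Rightarrow> real" and \<beta> :: real
  assumes f_cont: "continuous_on UNIV f"
    and f_zero: "f 0 = 0"
    and f_sign: "\<And>x. x \<noteq> 0 \<Longrightarrow> x * f x > 0"
    and f_odd: "\<exists>\<phi> :: real \<Rightarrow> real. (\<forall>x. \<phi> (- x) = - \<phi> x) \<and> ((\<lambda>x. f x / \<phi> x) \<longlongrightarrow> 1) (at 0)"
    and beta: "\<beta> > 1"
    and f_RV: "f \<in> RV0 \<beta>"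
    and f_sublinear: "((\<lambda>x. f x / x) \<longlongrightarrow> 0) (at_right 0)"
    and Gamma_C1: "\<Gamma> \<in> C1_maps {0..} {0<..}"
    and Gamma_lim: "filterlim \<Gamma> at_top at_top"
  shows "\<exists>g :: real \<Rightarrow> real.
      g \<in> C1_maps {0<..} {0<..} \<and> continuous_on {0..} g \<and>
      (\<exists>L::real. ((\<lambda>t::real. LBINT s=0..t. g s) \<longlongrightarrow> L) at_top) \<and>
      ((\<lambda>t::real. (LBINT s=t..\<infinity>. g s) / F_inv f t) \<longlongrightarrow> 0) at_top \<and>
      Limsup at_top (\<lambda>t. ereal (\<bar>g t\<bar> / \<Gamma> t)) = 1 \<and>
      (\<forall>\<xi> x. solves_on_half_line f g \<xi> x \<longrightarrow>
        (\<exists>c\<in>{-1, 0, 1}. ((\<lambda>t. x t / F_inv f t) \<longlongrightarrow> c) at_top))"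
proof -
  interpret regularly_varying_decay f \<beta>
    using f_RV beta f_sublinear continuous_on_subset[OF f_cont]
    by unfold_locales (auto simp: RV0_def)
  have f_reflect: "((\<lambda>u. - f (- u) / f u) \<longlongrightarrow> 1) (at_right 0)"
    using f_odd asymptotically_odd_reflection by blast
  have f_nz: "f u \<noteq> 0" if "u \<noteq> 0" for u
    using f_sign[OF that] by auto
  \<comment> \<open>The tail on \<open>{n..n + 1}\<close> has to be small for all \<open>t\<close> there; by monotonicity the endpoint \<open>n + 1\<close> is the worst case.\<close>
  have "\<exists>\<delta>>0. \<delta> \<le> F_inv f (real n + 1) / (real n + 1) \<and>
      (\<forall>u s. F_inv f ((real n + 1)\<^sup>2) \<le> \<bar>u\<bar> \<longrightarrow> \<bar>u\<bar> \<le> 1 \<longrightarrow> 0 \<le> s \<longrightarrow> s \<le> \<delta> \<longrightarrow>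
        \<bar>f (u - s) - f u\<bar> \<le> 1 / (real n + 1) * \<bar>f u\<bar>)" for n :: nat
  proof -
    have "F_inv f ((real n + 1)\<^sup>2) > 0" "F_inv f (real n + 1) / (real n + 1) > 0"
      by (auto intro!: F_inv_pos divide_pos_pos)
    with relative_modulus_of_continuity[OF f_cont f_nz, of "F_inv f ((real n + 1)\<^sup>2)" "1 / (real n + 1)"]
    obtain d where "d > 0" "\<And>u s. F_inv f ((real n + 1)\<^sup>2) \<le> \<bar>u\<bar> \<Longrightarrow> \<bar>u\<bar> \<le> 1 \<Longrightarrow> 0 \<le> s \<Longrightarrow> s \<le> d \<Longrightarrow>
        \<bar>f (u - s) - f u\<bar> \<le> 1 / (real n + 1) * \<bar>f u\<bar>"
      by (metis of_nat_0_le_iff add_nonneg_pos zero_less_one zero_less_divide_1_iff)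
    then show ?thesis
      using \<open>F_inv f (real n + 1) / (real n + 1) > 0\<close>
      by (intro exI[of _ "min d (F_inv f (real n + 1) / (real n + 1))"]) auto
  qed
  then obtain \<delta> :: "nat \<Rightarrow> real" where \<delta>: "\<And>n. \<delta> n > 0"
    and \<delta>_rate: "\<And>n. \<delta> n \<le> F_inv f (real n + 1) / (real n + 1)"
    and \<delta>_shift: "\<And>n u s. F_inv f ((real n + 1)\<^sup>2) \<le> \<bar>u\<bar> \<Longrightarrow> \<bar>u\<bar> \<le> 1 \<Longrightarrow> 0 \<le> s \<Longrightarrow> s \<le> \<delta> n \<Longrightarrow>
        \<bar>f (u - s) - f u\<bar> \<le> 1 / (real n + 1) * \<bar>f u\<bar>"
    by metis
  have mass_pos: "Min (\<delta> ` {..n}) / 2 ^ Suc n > 0" for n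
    using \<delta> by (intro divide_pos_pos) (auto simp: Min_gr_iff)
  obtain g where g: "g \<in> C1_maps {0<..} {0<..}" "continuous_on {0..} g" "\<And>t. 0 \<le> t \<Longrightarrow> 0 < g t"
      "Limsup at_top (\<lambda>t. ereal (\<bar>g t\<bar> / \<Gamma> t)) = 1"
      "\<And>n. integral {real n..real n + 1} g \<le> Min (\<delta> ` {..n}) / 2 ^ Suc n"
    by (rule C1_spikes_with_small_mass[OF Gamma_C1 mass_pos]) (rule that)
  obtain G :: "real \<Rightarrow> real" and L where L: "((\<lambda>t::real. LBINT s=0..t. g s) \<longlongrightarrow> L) at_top"
    and G: "\<And>t::real. 0 < t \<Longrightarrow> (LBINT s=t..\<infinity>. g s) = G t"
      "\<And>t. 0 < t \<Longrightarrow> (G has_real_derivative - g t) (at t)"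
      "\<And>t. 0 < t \<Longrightarrow> 0 < G t" "(G \<longlongrightarrow> 0) at_top"
    and G_le: "\<And>n t. real n \<le> t \<Longrightarrow> G t \<le> \<delta> n"
    by (rule tail_integral_below_sequence[OF g(2,3) \<delta> g(5)]) (assumption, rule that)
  have floor: "real (nat \<lfloor>t\<rfloor>) \<le> t" "t \<le> real (nat \<lfloor>t\<rfloor>) + 1" if "0 < t" for t
    using that by linarith+
  have G_rate: "G t / F_inv f t \<le> 1 / t" if t: "0 < t" for t
  proof -
    let ?n = "nat \<lfloor>t\<rfloor>"
    have "G t \<le> F_inv f (real ?n + 1) / (real ?n + 1)"
      using G_le[OF floor(1)[OF t]] \<delta>_rate[of ?n] by simp
    also have "\<dots> \<le> F_inv f t / t"
      using t floor[OF t] F_inv_pos[of t] by (intro frac_le F_inv_antimono) auto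
    finally show ?thesis
      using t F_inv_pos[of t] by (simp add: field_simps)
  qed
  have G_small: "((\<lambda>t. G t / F_inv f t) \<longlongrightarrow> 0) at_top"
  proof (rule tendsto_sandwich[OF _ _ tendsto_const])
    show "((\<lambda>t::real. 1 / t) \<longlongrightarrow> 0) at_top"
      by (intro tendsto_divide_0[OF tendsto_const] filterlim_at_top_imp_at_infinity filterlim_ident)
    show "\<forall>\<^sub>F t in at_top. G t / F_inv f t \<le> 1 / t"
      using eventually_gt_at_top[of 0] by eventually_elim (rule G_rate)
    show "\<forall>\<^sub>F t in at_top. 0 \<le> G t / F_inv f t"
      using eventually_gt_at_top[of 0]
      by eventually_elim (use G(3) F_inv_pos in \<open>force intro: divide_nonneg_pos less_imp_le\<close>)
  qed
  have shift: "\<bar>f (u - G t) - f u\<bar> \<le> \<bar>f u\<bar> / t"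
    if t: "0 < t" and u: "F_inv f (t\<^sup>2) \<le> \<bar>u\<bar>" "\<bar>u\<bar> \<le> 1" for t u
  proof -
    let ?n = "nat \<lfloor>t\<rfloor>"
    have "F_inv f ((real ?n + 1)\<^sup>2) \<le> F_inv f (t\<^sup>2)"
      using floor[OF t] t by (intro F_inv_antimono power_mono) auto
    then have "\<bar>f (u - G t) - f u\<bar> \<le> 1 / (real ?n + 1) * \<bar>f u\<bar>"
      using u G(3)[OF t] G_le[OF floor(1)[OF t]] by (intro \<delta>_shift) auto
    also have "\<dots> \<le> 1 / t * \<bar>f u\<bar>"
      using floor[OF t] t by (intro mult_right_mono frac_le) auto
    finally show ?thesis by simp
  qed
  show ?thesis
  proof (intro exI[of _ g] conjI allI impI)
    show "\<exists>L. ((\<lambda>t::real. LBINT s=0..t. g s) \<longlongrightarrow> L) at_top"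
      using L by blast
    have "\<forall>\<^sub>F t in at_top. G t / F_inv f t = (LBINT s=t..\<infinity>. g s) / F_inv f t"
      using eventually_gt_at_top[of 0] by eventually_elim (simp add: G(1))
    then show "((\<lambda>t::real. (LBINT s=t..\<infinity>. g s) / F_inv f t) \<longlongrightarrow> 0) at_top"
      by (rule Lim_transform_eventually[OF G_small])
    show "\<exists>c\<in>{-1, 0, 1}. ((\<lambda>t. x t / F_inv f t) \<longlongrightarrow> c) at_top"
      if "solves_on_half_line f g \<xi> x" for \<xi> x
      by (rule solution_trichotomy[OF f_cont f_zero f_sign f_reflect _ G(2,3,4) G_small shift])
         (use that g(3) in \<open>auto simp: solves_on_half_line_def\<close>)
  qed (use g in auto)
qed

end
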